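(* Let $\Sigma$ be a finite totally ordered alphabet and let $\prec$ denote $V$-order on $\Sigma^*$. For any strings $\mathbf{u},\mathbf{v},\mathbf{x},\mathbf{y}\in\Sigma^*$, $$\mathbf{x}\prec\mathbf{y}\iff \mathbf{u}\mathbf{x}\mathbf{v}\prec\mathbf{u}\mathbf{y}\mathbf{v}.$$
   Context: $\Sigma^*$ denotes the set of all finite strings over $\Sigma$, including the empty string $\varepsilon$. For a nonempty string $\mathbf{x}=x_1x_2\cdots x_n$, define $h\in\{1,\ldots,n\}$ by $h=1$ if $x_1\le x_2\le\cdots\le x_n$, and otherwise as the unique index with $x_{h-1}>x_h\le x_{h+1}\le\cdots\le x_n$; let $\mathbf{x}^*$ be the string obtained from $\mathbf{x}$ by deleting the letter $x_h$. Write $\mathbf{x}^{s*}$ for the result of applying $^*$ $s$ times ($\mathbf{x}^{0*}=\mathbf{x}$); the sequence $\mathbf{x},\mathbf{x}^*,\mathbf{x}^{2*},\ldots$ ends with $\varepsilon$. $V$-order $\prec$ is defined for distinct strings $\mathbf{x},\mathbf{y}$ as follows: $\mathbf{x}\prec\mathbf{y}$ if $\mathbf{x}$ occurs in the sequence $\mathbf{y},\mathbf{y}^*,\mathbf{y}^{2*},\ldots,\varepsilon$. If neither string occurs in the other's sequence, there are smallest $s,t\ge 0$ with $\mathbf{x}^{(s+1)*}=\mathbf{y}^{(t+1)*}$; put $\mathbf{s}=\mathbf{x}^{s*}$, $\mathbf{t}=\mathbf{y}^{t*}$, which are distinct strings of equal length $m$; let $j\in\{1,\ldots,m\}$ be the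 largest index with $\mathbf{s}[j]\ne\mathbf{t}[j]$; then $\mathbf{x}\prec\mathbf{y}$ iff $\mathbf{s}[j]<\mathbf{t}[j]$ in $\Sigma$. This is a strict total order on $\Sigma^*$. *)

theory Defs
  imports Main
begin

text \<open>
  Strings over a totally ordered alphabet are lists. List positions count from 0, so the
  1-based index \<open>h\<close> of the usual definition corresponds to \<open>vstar_index x + 1\<close>.
\<close>

definition vstar_index :: "'a::linorder list \<Rightarrow> nat" where
  "vstar_index x =
    (if sorted x then 0
     else (THE h. 0 < h \<and> h < length x \<and> x ! (h - 1) > x ! h \<and> sorted (drop h x)))"

text \<open>The empty string has no letter to delete; with this definition \<open>vstar [] = []\<close>, so that
  \<open>(vstar ^^ k) x\<close> runs through exactly \<open>x, x\<^sup>*, x\<^sup>2\<^sup>*, \<dots>, []\<close> as \<open>k\<close> ranges over the naturals.\<close>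

definition vstar :: "'a::linorder list \<Rightarrow> 'a list" where
  "vstar x = take (vstar_index x) x @ drop (Suc (vstar_index x)) x"

definition vseq :: "'a::linorder list \<Rightarrow> 'a list set" where
  "vseq x = {(vstar ^^ k) x | k. True}"

text \<open>The least exponent \<open>s\<close> such that \<open>x\<close> starred \<open>s + 1\<close> times is a string that \<open>y\<close> reaches
  after at least one star. If neither string occurs in the sequence of the other, then
  \<open>vbranch x y\<close> and \<open>vbranch y x\<close> are the smallest \<open>s, t\<close> with \<open>x\<close> starred \<open>s + 1\<close> times equal
  to \<open>y\<close> starred \<open>t + 1\<close> times.\<close>

definition vbranch :: "'a::linorder list \<Rightarrow> 'a list \<Rightarrow> nat" where
  "vbranch x y = (LEAST s. \<exists>t. (vstar ^^ (s + 1)) x = (vstar ^^ (t + 1)) y)"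

definition vless :: "'a::linorder list \<Rightarrow> 'a list \<Rightarrow> bool"  (infix \<open>\<prec>\<^sub>V\<close> 50) where
  "x \<prec>\<^sub>V y \<longleftrightarrow> x \<noteq> y \<and>
    (x \<in> vseq y \<or>
     x \<notin> vseq y \<and> y \<notin> vseq x \<and>
     (let s = (vstar ^^ vbranch x y) x;
          t = (vstar ^^ vbranch y x) y;
          j = (GREATEST j. j < length s \<and> s ! j \<noteq> t ! j)
      in s ! j < t ! j))"

end

theory Submission
  imports Defs "HOL-Library.Product_Lexorder" "HOL-Library.List_Lexorder"
begin

text \<open>
  The strings form a tree with root \<open>[]\<close> in which the parent of \<open>x\<close> is \<open>vstar x\<close>. Label the edge
  above \<open>x\<close> with the pair \<open>(d, a)\<close>, where \<open>a\<close> is the deleted letter and \<open>d\<close> the number of letters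
  behind it. For siblings, comparing the last differing letter amounts to comparing the labels
  lexicographically, so V-order is the preorder of this tree, i.e. the lexicographic order of
  the label sequences read from the root. Prepending or appending a letter \<open>c\<close> inserts one
  label into this sequence, at a place determined by comparison with \<open>c\<close> (appending also adds 1 to
  the counts \<open>d\<close> behind that place), and these insertions
  are strictly monotone.
\<close>

section \<open>The deleted letter\<close>

text \<open>A descent at the larger of two candidates would lie inside the sorted suffix starting at
  the smaller one. The alternative \<open>h = 0\<close> lets one statement cover sorted strings
  too.\<close>

lemma vstar_index_unique:
  assumes "h < length x" "h' < length x"
    and "h = 0 \<or> x ! (h - 1) > x ! h" "sorted (drop h x)"
    and "h' = 0 \<or> x ! (h' - 1) > x ! h'" "sorted (drop h' x)"
  shows "h = h'"
proof -
  have False if "i < j" "j < length x" "j = 0 \<or> x ! (j - 1) > x ! j" "sorted (drop i x)" for i j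
  proof -
    from that have "drop i x ! (j - 1 - i) \<le> drop i x ! (j - i)"
      by (intro sorted_nth_mono) auto
    with that show False by auto
  qed
  with assms show ?thesis by (metis linorder_neqE_nat)
qed

text \<open>Prepending a letter to \<open>x\<close> shifts the index of \<open>x\<close> by one. If
  that index was 0, \<open>x\<close> is sorted, so an unsorted \<open>c # x\<close> has its descent
  right at \<open>c\<close>.\<close>

lemma vstar_index_exists:
  assumes "x \<noteq> []"
  shows "\<exists>h < length x. (h = 0 \<or> x ! (h - 1) > x ! h) \<and> sorted (drop h x)"
  using assms
proof (induction x)
  case (Cons c x)
  show ?case
  proof (cases "sorted (c # x)")
    case True
    then show ?thesis by (intro exI[of _ 0]) auto
  next
    case False
    then have "x \<noteq> []" by auto
    with Cons.IH obtain h where h: "h < length x" "h = 0 \<or> x ! (h - 1) > x ! h" "sorted (drop h x)"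
      by blast
    have "(c # x) ! h > x ! h"
    proof (cases h)
      case 0
      with h False \<open>x \<noteq> []\<close> have "\<not> c \<le> hd x"
        by (cases x) auto
      with 0 \<open>x \<noteq> []\<close> show ?thesis by (simp add: hd_conv_nth)
    qed (use h in auto)
    with h show ?thesis by (intro exI[of _ "Suc h"]) auto
  qed
qed simp

lemma vstar_index:
  assumes "x \<noteq> []"
  shows "vstar_index x < length x"
    and "vstar_index x = 0 \<or> x ! (vstar_index x - 1) > x ! vstar_index x"
    and "sorted (drop (vstar_index x) x)"
proof -
  let ?Q = "\<lambda>h. h < length x \<and> (h = 0 \<or> x ! (h - 1) > x ! h) \<and> sorted (drop h x)"
  have "?Q (vstar_index x)"
  proof (cases "sorted x")
    case True
    with assms show ?thesis by (simp add: vstar_index_def)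
  next
    case False
    from vstar_index_exists[OF assms] obtain h where h: "?Q h" by blast
    with False have "h \<noteq> 0" by (metis drop0)
    then have "vstar_index x = h"
      unfolding vstar_index_def using False h
      by (auto intro!: the_equality dest: vstar_index_unique)
    with h show ?thesis by simp
  qed
  then show "vstar_index x < length x"
    and "vstar_index x = 0 \<or> x ! (vstar_index x - 1) > x ! vstar_index x"
    and "sorted (drop (vstar_index x) x)"
    by auto
qed

lemma vstar_index_eqI:
  assumes "h < length x" "h = 0 \<or> x ! (h - 1) > x ! h" "sorted (drop h x)"
  shows "vstar_index x = h"
proof -
  from assms have "x \<noteq> []" by auto
  from vstar_index_unique[OF vstar_index(1)[OF this] assms(1) vstar_index(2,3)[OF this] assms(2,3)]
  show ?thesis .
qed

lemma vstar_Nil [simp]: "vstar [] = []"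
  by (simp add: vstar_def)

lemma length_vstar: "length (vstar x) = length x - 1"
proof (cases "x = []")
  case False
  from vstar_index(1)[OF this] show ?thesis by (simp add: vstar_def)
qed simp

lemma vstar_index_Cons:
  assumes "x \<noteq> []"
  shows "vstar_index (c # x) = (if sorted (c # x) then 0 else Suc (vstar_index x))"
proof (cases "sorted (c # x)")
  case True
  then show ?thesis by (simp add: vstar_index_def)
next
  case False
  note h = vstar_index[OF assms]
  have "(c # x) ! vstar_index x > x ! vstar_index x"
  proof (cases "vstar_index x")
    case 0
    with h False assms have "\<not> c \<le> hd x"
      by (cases x) auto
    with 0 assms show ?thesis by (simp add: hd_conv_nth)
  qed (use h in auto)
  with h False show ?thesis by (auto intro!: vstar_index_eqI)
qed

lemma vstar_Cons:
  assumes "x \<noteq> []"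
  shows "vstar (c # x) = (if sorted (c # x) then x else c # vstar x)"
  using vstar_index_Cons[OF assms, of c] by (simp add: vstar_def)

text \<open>A new letter below the last one makes a descent just before itself; any other extends
  the sorted suffix, whose maximum is \<open>last x\<close>.\<close>

lemma vstar_index_snoc:
  assumes "x \<noteq> []"
  shows "vstar_index (x @ [c]) = (if last x > c then length x else vstar_index x)"
proof (cases "last x > c")
  case True
  with assms show ?thesis
    by (auto intro!: vstar_index_eqI simp: nth_append last_conv_nth)
next
  case False
  note h = vstar_index[OF assms]
  have "y \<le> c" if "y \<in> set (drop (vstar_index x) x)" for y
  proof -
    from that obtain i where i: "i < length (drop (vstar_index x) x)" "y = drop (vstar_index x) x ! i"
      by (metis in_set_conv_nth)
    then have "y \<le> drop (vstar_index x) x ! (length (drop (vstar_index x) x) - 1)"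
      using h by (auto intro!: sorted_nth_mono simp del: nth_drop length_drop)
    also have "\<dots> = last x"
      using h assms by (simp add: last_conv_nth)
    finally show ?thesis using False by simp
  qed
  moreover have "vstar_index x - Suc 0 < length x" using h(1) by simp
  ultimately show ?thesis
    using h False by (auto intro!: vstar_index_eqI simp: nth_append sorted_append)
qed

lemma vstar_snoc:
  assumes "x \<noteq> []"
  shows "vstar (x @ [c]) = (if last x > c then x else vstar x @ [c])"
  using vstar_index_snoc[OF assms, of c] vstar_index(1)[OF assms] by (simp add: vstar_def)

section \<open>Label sequences\<close>

text \<open>Counting from the right end keeps labels unchanged under prepending and gives the larger
  count to the larger of two siblings.\<close>

definition vlabel :: "'a::linorder list \<Rightarrow> nat \<times> 'a" where
  "vlabel x = (length x - Suc (vstar_index x), x ! vstar_index x)"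

function vcode :: "'a::linorder list \<Rightarrow> (nat \<times> 'a) list" where
  "vcode x = (if x = [] then [] else vcode (vstar x) @ [vlabel x])"
  by pat_completeness auto
termination
  by (relation "measure length") (auto simp: length_vstar)

declare vcode.simps [simp del]

lemma vcode_Nil [simp]: "vcode [] = []"
  by (simp add: vcode.simps)

lemma vcode_vstar: "x \<noteq> [] \<Longrightarrow> vcode x = vcode (vstar x) @ [vlabel x]"
  by (simp add: vcode.simps)

lemma vstar_induct [case_names Nil vstar]:
  assumes "P []" "\<And>x. x \<noteq> [] \<Longrightarrow> P (vstar x) \<Longrightarrow> P x"
  shows "P x"
proof (induction x rule: length_induct)
  case (1 x)
  then show ?case using assms by (cases "x = []") (auto simp: length_vstar)
qed

lemma length_vcode [simp]: "length (vcode x) = length x"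
  by (induction x rule: vstar_induct) (auto simp: vcode_vstar length_vstar)

text \<open>Each star drops the final label, so the ancestors of a string correspond to the prefixes
  of its code. Truncated subtraction matches \<open>vstar [] = []\<close>.\<close>

lemma vcode_funpow_vstar: "vcode ((vstar ^^ k) x) = take (length x - k) (vcode x)"
proof (induction k)
  case (Suc k)
  define z where "z = (vstar ^^ k) x"
  show ?case
  proof (cases "z = []")
    case True
    then have "take (length x - k) (vcode x) = []" using Suc z_def by simp
    with True show ?thesis by (auto simp flip: z_def)
  next
    case False
    have "vcode (vstar z) = butlast (vcode z)"
      by (simp add: vcode_vstar[OF False])
    also have "\<dots> = take (length x - Suc k) (vcode x)"
      using Suc by (simp add: z_def butlast_take)
    finally show ?thesis by (simp add: z_def)
  qed
qed simp

lemma insert_vlabel: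
  assumes "x \<noteq> []" "vlabel x = (d, a)"
  shows "x = take (length (vstar x) - d) (vstar x) @ a # drop (length (vstar x) - d) (vstar x)"
proof -
  note h = vstar_index(1)[OF assms(1)]
  then have "length (vstar x) - d = vstar_index x"
    using assms by (auto simp: vlabel_def length_vstar)
  moreover have "take (vstar_index x) x @ a # drop (Suc (vstar_index x)) x = x"
    using id_take_nth_drop[OF h] assms(2) by (simp add: vlabel_def)
  ultimately show ?thesis
    using h by (simp add: vstar_def)
qed

lemma vcode_inject [simp]: "vcode x = vcode y \<longleftrightarrow> x = y"
proof
  show "vcode x = vcode y \<Longrightarrow> x = y"
  proof (induction x arbitrary: y rule: vstar_induct)
    case Nil
    then show ?case by (metis length_0_conv length_vcode)
  next
    case (vstar x)
    then have "y \<noteq> []" by (metis length_0_conv length_vcode)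
    with vstar have "vstar x = vstar y" "vlabel x = vlabel y"
      by (auto simp: vcode_vstar)
    with insert_vlabel[OF \<open>x \<noteq> []\<close>] insert_vlabel[OF \<open>y \<noteq> []\<close>] show ?case
      by (metis surj_pair)
  qed
qed simp

section \<open>V-order as lexicographic order of label sequences\<close>

text \<open>Both strings insert one letter into the same parent \<open>r\<close>. If
  \<open>d < d'\<close>, then at the place where \<open>x\<close> has its inserted letter,
  \<open>y\<close> has the letter of \<open>r\<close> that precedes this place in \<open>x\<close>,
  which is larger by the descent. If \<open>d = d'\<close>, the inserted letters decide. Further
  right both strings agree.\<close>

lemma vlabel_less:
  assumes "x \<noteq> []" "y \<noteq> []" "vstar x = vstar y" "vlabel x < vlabel y"
  shows "\<exists>j < length x. x ! j < y ! j \<and> (\<forall>i. j < i \<and> i < length x \<longrightarrow> x ! i = y ! i)"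
proof -
  obtain d a d' a' where l: "vlabel x = (d, a)" "vlabel y = (d', a')" by fastforce
  define r where "r = vstar x"
  note x = insert_vlabel[OF assms(1) l(1), folded r_def]
  note y = insert_vlabel[OF assms(2) l(2), folded assms(3) r_def]
  have len: "length x = Suc (length r)" "length y = Suc (length r)"
    by (subst x y, simp)+
  have ix: "vstar_index x = length r - d" "d \<le> length r"
    and iy: "vstar_index y = length r - d'" "d' \<le> length r"
    using l vstar_index(1)[OF assms(1)] vstar_index(1)[OF assms(2)] len
    by (auto simp: vlabel_def)
  have a: "x ! (length r - d) = a" and a': "y ! (length r - d') = a'"
    using l ix iy by (auto simp: vlabel_def)
  have eq: "x ! i = y ! i" if "length r - d < i" "length r - d' < i" "i < length x" for i
    using that ix iy len by (subst x, subst y) (auto simp: nth_append nth_Cons' min_def)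
  show ?thesis
  proof (cases "d < d'")
    case True
    have "x ! (length r - d - 1) = r ! (length r - d - 1)"
      using True ix iy len by (subst x) (auto simp: nth_append)
    moreover have "y ! (length r - d) = r ! (length r - d - 1)"
      using True ix iy len by (subst y) (auto simp: nth_append nth_Cons' min_def)
    moreover have "x ! (length r - d - 1) > x ! (length r - d)"
      using vstar_index(2)[OF assms(1)] ix iy True by auto
    ultimately show ?thesis
      using True eq ix iy len by (intro exI[of _ "length r - d"]) auto
  next
    case False
    then have "d = d'" "a < a'" using assms(4) l by auto
    with a a' eq ix len show ?thesis by (intro exI[of _ "length r - d"]) auto
  qed
qed

lemma last_difference_less:
  fixes s t :: "'a::linorder list"
  assumes "\<exists>j < length s. s ! j < t ! j \<and> (\<forall>i. j < i \<and> i < length s \<longrightarrow> s ! i = t ! i)"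
  shows "let j = (GREATEST j. j < length s \<and> s ! j \<noteq> t ! j) in s ! j < t ! j"
    and "\<not> (let j = (GREATEST j. j < length s \<and> t ! j \<noteq> s ! j) in t ! j < s ! j)"
proof -
  from assms obtain j where j: "j < length s" "s ! j < t ! j"
    "\<And>i. j < i \<Longrightarrow> i < length s \<Longrightarrow> s ! i = t ! i" by blast
  then have "(GREATEST j. j < length s \<and> s ! j \<noteq> t ! j) = j"
    and "(GREATEST j. j < length s \<and> t ! j \<noteq> s ! j) = j"
    by (auto intro!: Greatest_equality simp: not_less[symmetric])
  with j show "let j = (GREATEST j. j < length s \<and> s ! j \<noteq> t ! j) in s ! j < t ! j"
    and "\<not> (let j = (GREATEST j. j < length s \<and> t ! j \<noteq> s ! j) in t ! j < s ! j)"
    by auto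
qed

lemma vseq_iff_take: "x \<in> vseq y \<longleftrightarrow> vcode x = take (length x) (vcode y)"
proof
  assume "x \<in> vseq y"
  then obtain k where "x = (vstar ^^ k) y" by (auto simp: vseq_def)
  then have "vcode x = take (length y - k) (vcode y)"
    by (simp add: vcode_funpow_vstar)
  then show "vcode x = take (length x) (vcode y)"
    by (metis length_vcode length_take append_take_drop_id append_eq_conv_conj)
next
  assume *: "vcode x = take (length x) (vcode y)"
  then have "length x \<le> length y"
    by (metis length_vcode length_take min.absorb_iff1 min.commute)
  with * have "vcode x = vcode ((vstar ^^ (length y - length x)) y)"
    by (simp add: vcode_funpow_vstar)
  then show "x \<in> vseq y" by (auto simp: vseq_def)
qed

lemma vbranch_vcode:
  assumes "vcode x = p @ a # q" "vcode y = p @ b # q'" "a \<noteq> b"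
  shows "vbranch x y = length q"
proof -
  have len: "length x = Suc (length p + length q)" "length y = Suc (length p + length q')"
    using assms by (metis length_vcode length_append length_Cons add_Suc_right)+
  show ?thesis
    unfolding vbranch_def
  proof (rule Least_equality)
    have "vcode ((vstar ^^ (length q + 1)) x) = vcode ((vstar ^^ (length q' + 1)) y)"
      unfolding vcode_funpow_vstar using assms len by simp
    then show "\<exists>t. (vstar ^^ (length q + 1)) x = (vstar ^^ (t + 1)) y"
      unfolding vcode_inject by blast
  next
    fix s assume "\<exists>t. (vstar ^^ (s + 1)) x = (vstar ^^ (t + 1)) y"
    then obtain t where "vcode ((vstar ^^ (s + 1)) x) = vcode ((vstar ^^ (t + 1)) y)" by auto
    then have *: "take (length x - (s + 1)) (vcode x) = take (length y - (t + 1)) (vcode y)"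
      unfolding vcode_funpow_vstar .
    show "length q \<le> s"
    proof (rule ccontr)
      assume "\<not> length q \<le> s"
      \<comment> \<open>With so few stars the position \<open>length p\<close> survives, where the
        codes carry the different labels \<open>a\<close> and \<open>b\<close>.\<close>
      then have less: "length p < length x - (s + 1)" using len by simp
      from arg_cong[OF *, of length] have "length x - (s + 1) = length y - (t + 1)" by simp
      with less arg_cong[OF *, of "\<lambda>l. l ! length p"] have "vcode x ! length p = vcode y ! length p"
        by simp
      with assms show False by simp
    qed
  qed
qed

text \<open>Undoing the stars just before the two sequences meet leads to siblings with codes
  \<open>p @ [a]\<close> and \<open>p @ [b]\<close>, to which the comparison of sibling labels
  applies.\<close>

lemma vless_branch_iff:
  assumes "vcode x = p @ a # q" "vcode y = p @ b # q'" "a < b"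
  shows "x \<prec>\<^sub>V y" and "\<not> y \<prec>\<^sub>V x"
proof -
  have len: "length x = Suc (length p + length q)" "length y = Suc (length p + length q')"
    using assms by (metis length_vcode length_append length_Cons add_Suc_right)+
  define s where "s = (vstar ^^ vbranch x y) x"
  define t where "t = (vstar ^^ vbranch y x) y"
  have vb: "vbranch x y = length q" "vbranch y x = length q'"
    using vbranch_vcode[OF assms(1,2)] vbranch_vcode[OF assms(2,1)] assms(3) by auto
  have cs: "vcode s = p @ [a]" and ct: "vcode t = p @ [b]"
    unfolding s_def t_def vcode_funpow_vstar vb using assms len by auto
  then have ne: "s \<noteq> []" "t \<noteq> []" by auto
  have "vcode (vstar s) = p" "vcode (vstar t) = p" and st: "vlabel s = a" "vlabel t = b"
    using cs ct vcode_vstar[OF ne(1)] vcode_vstar[OF ne(2)] by auto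
  then have eq: "vstar s = vstar t" by (metis vcode_inject)
  have ls: "length s = length t"
    using cs ct by (metis length_vcode length_append_singleton)
  from vlabel_less[OF ne eq] st assms(3)
  have "\<exists>j < length s. s ! j < t ! j \<and> (\<forall>i. j < i \<and> i < length s \<longrightarrow> s ! i = t ! i)" by simp
  note less = last_difference_less[OF this]
  have "x \<notin> vseq y" "y \<notin> vseq x"
    using assms len by (auto simp: vseq_iff_take)
  moreover have "x \<noteq> y" using assms by auto
  ultimately show "x \<prec>\<^sub>V y" and "\<not> y \<prec>\<^sub>V x"
    using less ls unfolding vless_def s_def[symmetric] t_def[symmetric] by (auto simp: Let_def)
qed

lemma vless_prefix:
  assumes "vcode y = vcode x @ a # q"
  shows "x \<prec>\<^sub>V y" and "\<not> y \<prec>\<^sub>V x"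
proof -
  have len: "length y = Suc (length x + length q)"
    using arg_cong[OF assms, of length] by simp
  with assms have "x \<noteq> y" "x \<in> vseq y" "y \<notin> vseq x"
    by (auto simp: vseq_iff_take)
  then show "x \<prec>\<^sub>V y" and "\<not> y \<prec>\<^sub>V x" by (auto simp: vless_def)
qed

lemma vless_iff_vcode_less: "x \<prec>\<^sub>V y \<longleftrightarrow> vcode x < vcode y"
proof -
  have *: "x \<prec>\<^sub>V y \<and> \<not> y \<prec>\<^sub>V x" if "vcode x < vcode y" for x y :: "'a list"
  proof -
    \<comment> \<open>The two ways of being lexicographically smaller match the two clauses of
      V-order: proper prefix means ancestor, first differing label means branching.\<close>
    from that consider a q where "vcode y = vcode x @ a # q"
      | p a b q q' where "vcode x = p @ a # q" "vcode y = p @ b # q'" "a < b"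
      unfolding list_less_def lexord_def by blast
    then show ?thesis
    proof cases
      case 1
      then show ?thesis by (simp add: vless_prefix)
    next
      case 2
      from vless_branch_iff[OF this] show ?thesis by simp
    qed
  qed
  show ?thesis
    using *[of x y] *[of y x] by (cases "vcode x" "vcode y" rule: linorder_cases) (auto simp: vless_def)
qed

section \<open>Prepending a letter\<close>

text \<open>The counter \<open>n\<close> is the length of the ancestor reached so far; a front
  letter \<open>c\<close> deleted from \<open>c\<close> followed by that ancestor has label
  \<open>(n, c)\<close>.\<close>

fun insert_prepend :: "nat \<Rightarrow> 'a::linorder \<Rightarrow> (nat \<times> 'a) list \<Rightarrow> (nat \<times> 'a) list" where
  "insert_prepend n c [] = [(n, c)]"
| "insert_prepend n c (l # L) =
    (if (n, c) \<le> l then l # insert_prepend (Suc n) c L else (n, c) # l # L)"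

lemma insert_prepend_strict_mono:
  "L < M \<Longrightarrow> insert_prepend n c L < insert_prepend n c M"
proof (induction n c L arbitrary: M rule: insert_prepend.induct)
  case (1 n c)
  then obtain m M' where "M = m # M'" by (cases M) auto
  then show ?case by (cases M') auto
next
  case (2 n c l L)
  then obtain m M' where M: "M = m # M'" by (cases M) auto
  \<comment> \<open>Settles the tie \<open>m = (n, c)\<close>, where both results start alike: the
    remainder on the right starts with a label at least \<open>(Suc n, c)\<close>, which exceeds
    \<open>l\<close>.\<close>
  have *: "l # L < insert_prepend (Suc n) c M'" if "l < (n, c)"
  proof -
    from that have "l < (Suc n, c)" by (cases l) auto
    then show ?thesis
      by (cases M') (auto simp del: less_prod_simp less_eq_prod_simp dest: order.strict_trans2)
  qed
  show ?case
    using 2 M * by (auto simp: not_le)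
qed

text \<open>The insertion scans from the root, whereas \<open>vcode\<close> grows at the leaf end;
  this mediates between the two.\<close>

lemma insert_prepend_snoc:
  "insert_prepend n c (L @ [l]) =
    (if (\<forall>k < length L. (n + k, c) \<le> L ! k) \<and> (n + length L, c) \<le> l
     then L @ [l, (n + length L + 1, c)] else insert_prepend n c L @ [l])"
  by (induction n c L rule: insert_prepend.induct) (auto simp: All_less_Suc2)

text \<open>The label at position \<open>k\<close> has count at most \<open>k\<close>, so the
  inequality says that the first letter is deleted there and is at least \<open>c\<close>.\<close>

lemma sorted_Cons_iff_vcode:
  "sorted (c # x) \<longleftrightarrow> (\<forall>k < length x. (k, c) \<le> vcode x ! k)"
proof (induction x rule: vstar_induct)
  case (vstar x)
  note h = vstar_index[OF vstar(1)]
  have len: "length x = Suc (length (vstar x))" using vstar(1) by (cases x) (auto simp: length_vstar)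
  have "(\<forall>k < length x. (k, c) \<le> vcode x ! k) \<longleftrightarrow>
      sorted (c # vstar x) \<and> (length (vstar x), c) \<le> vlabel x"
    unfolding vstar(2) vcode_vstar[OF vstar(1)] len by (auto simp: nth_append less_Suc_eq)
  also have "(length (vstar x), c) \<le> vlabel x \<longleftrightarrow> vstar_index x = 0 \<and> c \<le> x ! 0"
    using h(1) len by (cases "vstar_index x") (auto simp: vlabel_def)
  also have "sorted (c # vstar x) \<and> vstar_index x = 0 \<and> c \<le> x ! 0 \<longleftrightarrow> sorted (c # x)"
  proof (cases "vstar_index x = 0")
    case True
    with h(3) vstar(1) show ?thesis by (cases x) (auto simp: vstar_def)
  next
    case False
    then have "\<not> sorted x" by (auto simp: vstar_index_def)
    with False show ?thesis by simp
  qed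
  finally show ?case by simp
qed simp

lemma vlabel_Cons:
  "x \<noteq> [] \<Longrightarrow> vlabel (c # x) = (if sorted (c # x) then (length x, c) else vlabel x)"
  using vstar_index_Cons[of x c] by (simp add: vlabel_def)

text \<open>If \<open>c # x\<close> is sorted, \<open>c\<close> goes first and its label ends the
  code; otherwise \<open>x\<close> loses its own letter, with the same label.\<close>

lemma vcode_Cons: "vcode (c # x) = insert_prepend 0 c (vcode x)"
proof (induction x rule: vstar_induct)
  case Nil
  show ?case by (simp add: vcode_vstar length_vstar vstar_def vlabel_def vstar_index_def)
next
  case (vstar x)
  have len: "length x = Suc (length (vstar x))" using vstar(1) by (cases x) (auto simp: length_vstar)
  have *: "sorted (c # x) \<longleftrightarrow>
      (\<forall>k < length (vstar x). (k, c) \<le> vcode (vstar x) ! k) \<and> (length (vstar x), c) \<le> vlabel x"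
    unfolding sorted_Cons_iff_vcode vcode_vstar[OF vstar(1)] len
    by (auto simp: nth_append less_Suc_eq)
  have "insert_prepend 0 c (vcode x) =
      (if sorted (c # x) then vcode x @ [(length x, c)]
       else insert_prepend 0 c (vcode (vstar x)) @ [vlabel x])"
    unfolding * using len by (auto simp: vcode_vstar[OF vstar(1)] insert_prepend_snoc)
  with vstar show ?case
    by (simp add: vcode_vstar[of "c # x"] vstar_Cons vlabel_Cons)
qed

section \<open>Appending a letter\<close>

text \<open>An appended \<open>c\<close> has nothing behind it when deleted, hence
  \<open>(0, c)\<close>. Labels nearer the leaf belong to deletions made while \<open>c\<close> is
  still present, so their counts rise by one.\<close>

fun insert_append :: "'a::linorder \<Rightarrow> (nat \<times> 'a) list \<Rightarrow> (nat \<times> 'a) list" where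
  "insert_append c [] = [(0, c)]"
| "insert_append c (l # L) =
    (if (0, c) < l then l # insert_append c L else (0, c) # map (apfst Suc) (l # L))"

lemma map_apfst_Suc_strict_mono:
  fixes L M :: "(nat \<times> 'a::linorder) list"
  shows "L < M \<Longrightarrow> map (apfst Suc) L < map (apfst Suc) M"
proof (induction L arbitrary: M)
  case Nil
  then show ?case by (cases M) auto
next
  case (Cons l L)
  then show ?case by (cases l; cases M) auto
qed

lemma insert_append_strict_mono:
  "L < M \<Longrightarrow> insert_append c L < insert_append c M"
proof (induction c L arbitrary: M rule: insert_append.induct)
  case (1 c)
  then show ?case by (cases M) auto
next
  case (2 c l L)
  then obtain m M' where M: "M = m # M'" by (cases M) auto
  show ?case
  proof (cases "(0, c) < l")
    case True
    with 2 M show ?thesis by auto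
  next
    case False
    with map_apfst_Suc_strict_mono[OF 2(2)] M show ?thesis by auto
  qed
qed

lemma insert_append_snoc:
  "insert_append c (L @ [l]) =
    (if (\<forall>k \<in> set L. (0, c) < k) \<and> (0, c) < l then L @ [l, (0, c)]
     else insert_append c L @ [apfst Suc l])"
  by (induction c L rule: insert_append.induct) auto

text \<open>Labels with positive count exceed \<open>(0, c)\<close> anyway and leave the last letter
  in place. Deleting the last letter of a longer string exposes a larger one, by the descent, so
  \<open>c < last x\<close> passes to all nonempty ancestors.\<close>

lemma last_greater_iff_vcode:
  "x = [] \<or> c < last x \<longleftrightarrow> (\<forall>l \<in> set (vcode x). (0, c) < l)"
proof (induction x rule: vstar_induct)
  case (vstar x)
  note h = vstar_index[OF vstar(1)]
  have "(\<forall>l \<in> set (vcode x). (0, c) < l) \<longleftrightarrow>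
      (vstar x = [] \<or> c < last (vstar x)) \<and> (0, c) < vlabel x"
    unfolding vstar(2) vcode_vstar[OF vstar(1)] by auto
  also have "\<dots> \<longleftrightarrow> c < last x"
  proof (cases "Suc (vstar_index x) = length x")
    case True
    then have eq: "vlabel x = (0, last x)" "vstar x = take (length x - 1) x"
      using vstar(1) by (auto simp: vlabel_def vstar_def last_conv_nth simp flip: True)
    show ?thesis
    proof (cases "length x = 1")
      case False
      with True have "last (vstar x) > last x"
        using h(2) vstar(1) unfolding eq(2)
        by (auto simp: last_conv_nth simp flip: True)
      with eq show ?thesis by auto
    qed (use eq in auto)
  next
    case False
    with h(1) have "last (vstar x) = last x" "vstar x \<noteq> []" "(0, c) < vlabel x"
      by (auto simp: vstar_def vlabel_def)
    then show ?thesis by simp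
  qed
  finally show ?case using vstar(1) by simp
qed simp

lemma vlabel_snoc:
  assumes "x \<noteq> []"
  shows "vlabel (x @ [c]) = (if last x > c then (0, c) else apfst Suc (vlabel x))"
  using vstar_index_snoc[OF assms, of c] vstar_index(1)[OF assms]
  by (auto simp: vlabel_def nth_append)

lemma vcode_snoc: "vcode (x @ [c]) = insert_append c (vcode x)"
proof (induction x rule: vstar_induct)
  case Nil
  show ?case by (simp add: vcode_vstar length_vstar vstar_def vlabel_def vstar_index_def)
next
  case (vstar x)
  have "c < last x \<longleftrightarrow> (\<forall>l \<in> set (vcode (vstar x)). (0, c) < l) \<and> (0, c) < vlabel x"
    using last_greater_iff_vcode[of x c] vstar(1) by (auto simp: vcode_vstar)
  with vstar show ?case
    by (simp add: vcode_vstar[of "x @ [c]"] vcode_vstar[of x] vstar_snoc vlabel_snoc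
        insert_append_snoc)
qed

section \<open>Compatibility with concatenation\<close>

lemma vcode_append_left_mono: "vcode x < vcode y \<Longrightarrow> vcode (u @ x) < vcode (u @ y)"
  by (induction u) (auto simp: vcode_Cons insert_prepend_strict_mono)

lemma vcode_append_right_mono: "vcode x < vcode y \<Longrightarrow> vcode (x @ v) < vcode (y @ v)"
proof (induction v rule: rev_induct)
  case (snoc c v)
  then show ?case
    using vcode_snoc[of "x @ v" c] vcode_snoc[of "y @ v" c]
    by (simp add: insert_append_strict_mono)
qed simp

theorem theorem2:
  fixes u v x y :: "'a::{finite,linorder} list"
  shows "x \<prec>\<^sub>V y \<longleftrightarrow> u @ x @ v \<prec>\<^sub>V u @ y @ v"
proof -
  have mono: "vcode (u @ x @ v) < vcode (u @ y @ v)" if "vcode x < vcode y" for x y :: "'a list"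
    using that by (intro vcode_append_left_mono vcode_append_right_mono)
  \<comment> \<open>Codes are linearly ordered, so strict monotonicity also reflects the order: if
    \<open>x\<close> is not below \<open>y\<close>, they are equal or \<open>mono\<close> applies
    with the roles exchanged.\<close>
  show ?thesis
    unfolding vless_iff_vcode_less
    using mono[of x y] mono[of y x]
    by (cases "vcode x" "vcode y" rule: linorder_cases) auto
qed

end
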